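(* Let $\nu > \frac12$. There exists a constant $C_\nu$, depending only on $\nu$ (independent of $n$, $x$, $y$ and $\lambda$), such that for every real $\lambda < 2\nu$ and every $n \in \mathbb{N}$ the co-dilated ultraspherical polynomials $P_n^{(\nu)*}$ satisfy, for all $x\in[-1,1]$, $$\left| \frac{P_n^{(\nu)*}(x)}{P_n^{(\nu)*}(1)}\right| \leq \frac{1+|\lambda|}{2\nu-\lambda}\, \frac{C_{\nu}}{(\sqrt{1-x^2}\, n + 1)^{\nu}},$$ and the residual polynomials $r_n^{(\nu)*}(y) = \frac{P_n^{(\nu)*}(1-2y)}{P_n^{(\nu)*}(1)}$, $y\in[0,1]$, and the modulus of convergence $\varepsilon_\nu^S(n)$ satisfy $$\left| r_n^{(\nu)*}(y)\right| \leq \frac{1+|\lambda|}{2\nu-\lambda}\, \frac{C_\nu}{(2\sqrt{y(1-y)}\,n+1)^\nu} \quad (y\in[0,1]), \qquad \varepsilon_\nu^S(n) \leq \frac{1+|\lambda|}{2\nu-\lambda}\, \frac{C_\nu}{(2n)^\nu}.$$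
   Context: $\mathbb{N}=\{1,2,\dots\}$. For $\nu>\frac12$ put $$\beta_n = \frac{n(n+2\nu-1)}{4(n+\nu)(n+\nu-1)},\qquad n\in\mathbb{N}.$$ These are the recurrence coefficients of the monic ultraspherical polynomials $P_n^{(\nu)}$, which are orthogonal on $[-1,1]$ with respect to the weight $w_\nu(x)=(1-x^2)^{\nu-\frac12}$: $P_0^{(\nu)}=1$, $P_1^{(\nu)}(x)=x$, $P_{n+1}^{(\nu)}(x)=xP_n^{(\nu)}(x)-\beta_nP_{n-1}^{(\nu)}(x)$ for $n\ge 1$. For $\lambda\in\mathbb{R}$, the co-dilated ultraspherical polynomials $P_n^{(\nu)*}(x)=P_n^{(\nu)*}(x,\lambda)$ are defined by multiplying the first coefficient $\beta_1$ by $\lambda$: $$P_0^{(\nu)*}(x)=1,\quad P_1^{(\nu)*}(x)=x,\quad P_2^{(\nu)*}(x)=x^2-\lambda\beta_1,\quad P_{n+1}^{(\nu)*}(x)=xP_n^{(\nu)*}(x)-\beta_nP_{n-1}^{(\nu)*}(x)\ \ (n\ge2).$$ The (symmetric) modulus of convergence is $$\varepsilon_\nu^S(n)=\sup_{y\in[0,1]}\left|y^{\frac{\nu}{2}}(1-y)^{\frac{\nu}{2}}\,r_n^{(\nu)*}(y)\right|.$$ *)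

theory Defs
  imports "HOL-Analysis.Analysis" "HOL-Computational_Algebra.Polynomial"
begin

definition ultra_beta :: "real \<Rightarrow> nat \<Rightarrow> real" where
  "ultra_beta \<nu> n =
     (real n * (real n + 2 * \<nu> - 1)) / (4 * (real n + \<nu>) * (real n + \<nu> - 1))"

text \<open>\<open>codilated \<nu> lam n\<close> is the monic polynomial \<open>P\<^sub>n\<close> with co-dilation parameter \<open>lam\<close>;
  only the coefficient \<open>\<beta>\<^sub>1\<close> of the ultraspherical recurrence is multiplied by \<open>lam\<close>.\<close>

fun codilated :: "real \<Rightarrow> real \<Rightarrow> nat \<Rightarrow> real poly" where
  "codilated \<nu> lam 0 = 1"
| "codilated \<nu> lam (Suc 0) = [:0, 1:]"
| "codilated \<nu> lam (Suc (Suc 0)) = [:0, 1:] ^ 2 - [:lam * ultra_beta \<nu> 1:]"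
| "codilated \<nu> lam (Suc (Suc (Suc n))) =
     [:0, 1:] * codilated \<nu> lam (Suc (Suc n))
     - smult (ultra_beta \<nu> (Suc (Suc n))) (codilated \<nu> lam (Suc n))"

definition residual :: "real \<Rightarrow> real \<Rightarrow> nat \<Rightarrow> real \<Rightarrow> real" where
  "residual \<nu> lam n y = poly (codilated \<nu> lam n) (1 - 2 * y) / poly (codilated \<nu> lam n) 1"

text \<open>For \<open>\<nu> > 0\<close> the supremum is over a bounded nonempty set of reals (a continuous
  function on a compact interval), so the conditionally complete \<open>Sup\<close> is the genuine one.\<close>

definition modulus_conv :: "real \<Rightarrow> real \<Rightarrow> nat \<Rightarrow> real" where
  "modulus_conv \<nu> lam n =
     (SUP y\<in>{0..1}. \<bar>y powr (\<nu> / 2) * (1 - y) powr (\<nu> / 2) * residual \<nu> lam n y\<bar>)"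

end

theory Submission
  imports Defs
begin

text \<open>Write \<open>P\<^sub>n\<close> for the ultraspherical and \<open>Q\<^sub>n\<close> for the associated polynomials (the second
  solution of the recurrence), so that \<open>P\<^sub>n\<^sup>* = \<lambda> P\<^sub>n + (1 - \<lambda>) x Q\<^sub>n\<close>. It suffices to bound every
  solution \<open>u\<^sub>n\<close> of the recurrence, normalised by \<open>P\<^sub>n(1)\<close>, by a constant times \<open>(n s + 1)\<^sup>-\<^sup>\<nu>\<close> with
  \<open>s = sqrt (1 - x\<^sup>2)\<close>, and to compute \<open>P\<^sub>n\<^sup>*(1) / P\<^sub>n(1)\<close>, which at \<open>x = 1\<close> is a telescoping sum.

  While \<open>n s \<le> 1\<close>, a bootstrap on \<open>u\<^sub>n\<close> and \<open>e\<^sub>n = x u\<^sub>n - u\<^sub>n\<^sub>+\<^sub>1\<close> shows that \<open>u\<^sub>n\<close> is bounded; here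
  \<open>2 \<nu> > 1\<close> makes the undriven part of \<open>e\<^sub>n\<close>, which decays like \<open>n\<^sup>-\<^sup>2\<^sup>\<nu>\<close>, summable. Afterwards the
  energy \<open>s\<^sup>2 u\<^sub>n\<^sup>2 + e\<^sub>n\<^sup>2\<close> is nonincreasing, which keeps \<open>u\<^sub>n\<close> bounded. The decay comes from a
  Turan-type quadratic form \<open>T\<^sub>n\<close> in \<open>u\<^sub>n, u\<^sub>n\<^sub>+\<^sub>1\<close>: with a weight \<open>h\<^sub>n\<close> of order \<open>n\<^sup>2\<^sup>\<nu>\<close> one has
  \<open>h\<^sub>n\<^sub>+\<^sub>1 T\<^sub>n\<^sub>+\<^sub>1 = h\<^sub>n T\<^sub>n (1 + O(n\<^sup>-\<^sup>3 s\<^sup>-\<^sup>2))\<close>, and \<open>T\<^sub>n\<close> dominates \<open>s\<^sup>2 u\<^sub>n\<^sup>2\<close> once \<open>n s\<close> is large. Since the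
  relative errors sum to \<open>O(1)\<close> over \<open>n \<ge> 1 / s\<close>, \<open>u\<^sub>n\<^sup>2\<close> is at most of order \<open>(n s)\<^sup>-\<^sup>2\<^sup>\<nu>\<close>.\<close>

section \<open>The damping factors\<close>

text \<open>This is \<open>n! / ((2 * \<nu> + 1) ... (2 * \<nu> + n))\<close>, of order
  \<open>n powr (- 2 * \<nu>)\<close>: the accumulated contraction factors of
  \<open>e_Suc\<close>.\<close>

definition damping :: "real \<Rightarrow> nat \<Rightarrow> real" where
  "damping \<nu> n = (\<Prod>k<n. (real k + 1) / (real k + 1 + 2 * \<nu>))"

lemma damping_0 [simp]: "damping \<nu> 0 = 1"
  by (simp add: damping_def)

lemma damping_Suc: "damping \<nu> (Suc n) = damping \<nu> n * ((real n + 1) / (real n + 1 + 2 * \<nu>))"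
  by (simp add: damping_def)

lemma damping_pos: "\<nu> > 0 \<Longrightarrow> damping \<nu> n > 0"
  unfolding damping_def by (rule prod_pos) (auto simp: divide_simps)

text \<open>Telescoping: \<open>(k + 2 * \<nu>) * damping \<nu> k\<close> drops by
  \<open>(2 * \<nu> - 1) * damping \<nu> k\<close> when \<open>k\<close> increases by one.\<close>

lemma sum_damping:
  assumes "\<nu> > 0"
  shows "(2 * \<nu> - 1) * (\<Sum>k<n. damping \<nu> k) = 2 * \<nu> - (real n + 2 * \<nu>) * damping \<nu> n"
proof (induction n)
  case (Suc n)
  have "(real (Suc n) + 2 * \<nu>) * damping \<nu> (Suc n) = (real n + 1) * damping \<nu> n"
    using assms by (simp add: damping_Suc field_simps)
  with Suc show ?case by (simp add: algebra_simps)
qed simp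

lemma damping_le:
  assumes "\<nu> > 1/2"
  shows "damping \<nu> n \<le> 2 * \<nu> / (real n + 2 * \<nu>)"
proof -
  have "0 \<le> (2 * \<nu> - 1) * (\<Sum>k<n. damping \<nu> k)"
    using assms damping_pos[of \<nu>] by (intro mult_nonneg_nonneg sum_nonneg) (auto simp: less_imp_le)
  then have "(real n + 2 * \<nu>) * damping \<nu> n \<le> 2 * \<nu>"
    using assms sum_damping[of \<nu> n] by simp
  then show ?thesis using assms by (simp add: field_simps)
qed

text \<open>The remainder in \<open>sum_damping\<close> is positive and
  \<open>2 * \<nu> > 1\<close>, so the sums are bounded uniformly in \<open>n\<close>.\<close>

lemma sum_damping_less:
  assumes "\<nu> > 1/2"
  shows "(\<Sum>k<n. damping \<nu> k) < 2 * \<nu> / (2 * \<nu> - 1)"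
proof -
  have "(real n + 2 * \<nu>) * damping \<nu> n > 0"
    using assms damping_pos[of \<nu> n] by simp
  then have "(2 * \<nu> - 1) * (\<Sum>k<n. damping \<nu> k) < 2 * \<nu>"
    using assms sum_damping[of \<nu> n] by linarith
  then show ?thesis using assms by (simp add: field_simps)
qed

lemma sum_damping_ge:
  assumes "\<nu> > 0" "n \<ge> 2"
  shows "(\<Sum>k<n. damping \<nu> k) \<ge> 1 + 1 / (2 * \<nu> + 1)"
proof -
  have "(\<Sum>k<2. damping \<nu> k) \<le> (\<Sum>k<n. damping \<nu> k)"
    using assms damping_pos[of \<nu>] by (intro sum_mono2) (auto simp: less_imp_le)
  then show ?thesis by (simp add: numeral_2_eq_2 damping_Suc add.commute)
qed

text \<open>Bernoulli's inequality makes \<open>damping \<nu> n * (n + 2 \<nu>) powr (2 \<nu>)\<close> nonincreasing.\<close>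

lemma damping_ratio_le:
  assumes nu: "\<nu> > 1/2" and m: "1 \<le> m" "m \<le> n"
  shows "damping \<nu> n / damping \<nu> m \<le> ((1 + 2 * \<nu>) * (real m / real n)) powr (2 * \<nu>)"
proof -
  let ?g = "\<lambda>n. damping \<nu> n * (real n + 2 * \<nu>) powr (2 * \<nu>)"
  have step: "?g (Suc k) \<le> ?g k" for k
  proof -
    define N where "N = real k + 1 + 2 * \<nu>"
    define y where "y = (real k + 1) / N"
    have N: "N > 1" "y > 0" "y = 1 - 2 * \<nu> / N"
      using nu by (auto simp: N_def y_def field_simps)
    \<comment> \<open>Weighted AM-GM for \<open>y\<close> and 1; the weight
      \<open>1 / (2 * \<nu>)\<close> lies in (0,1) because \<open>2 * \<nu> > 1\<close>.\<close>
    have "y powr (1 / (2 * \<nu>)) * 1 powr (1 - 1 / (2 * \<nu>)) \<le> 1 / (2 * \<nu>) * y + (1 - 1 / (2 * \<nu>)) * 1"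
      using nu N by (intro Youngs_inequality_0) auto
    also have "\<dots> = (N - 1) / N"
      using nu N by (simp add: field_simps)
    finally have "(y powr (1 / (2 * \<nu>))) powr (2 * \<nu>) \<le> ((N - 1) / N) powr (2 * \<nu>)"
      using nu by (intro powr_mono2) auto
    then have "y \<le> (N - 1) powr (2 * \<nu>) / N powr (2 * \<nu>)"
      using nu N by (simp add: powr_powr powr_divide)
    then have "y * N powr (2 * \<nu>) \<le> (N - 1) powr (2 * \<nu>)"
      using N(1) by (simp add: pos_le_divide_eq)
    then have "damping \<nu> k * (y * N powr (2 * \<nu>)) \<le> damping \<nu> k * (N - 1) powr (2 * \<nu>)"
      using nu damping_pos[of \<nu> k] by (intro mult_left_mono) auto
    moreover have "damping \<nu> (Suc k) = damping \<nu> k * y"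
      by (simp add: damping_Suc y_def N_def)
    moreover have "real (Suc k) + 2 * \<nu> = N" "real k + 2 * \<nu> = N - 1"
      by (auto simp: N_def)
    ultimately show ?thesis by (metis mult.assoc)
  qed
  have pos: "damping \<nu> m > 0" "(real n + 2 * \<nu>) powr (2 * \<nu>) > 0" using nu damping_pos by auto
  have "?g n \<le> ?g m"
    using m(2) step by (rule lift_Suc_antimono_le[of ?g, rotated])
  then have "damping \<nu> n / damping \<nu> m \<le> (real m + 2 * \<nu>) powr (2 * \<nu>) / (real n + 2 * \<nu>) powr (2 * \<nu>)"
    using pos by (simp add: field_simps)
  also have "\<dots> = ((real m + 2 * \<nu>) / (real n + 2 * \<nu>)) powr (2 * \<nu>)"
    using nu by (simp add: powr_divide)
  also have "\<dots> \<le> ((1 + 2 * \<nu>) * (real m / real n)) powr (2 * \<nu>)"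
  proof (rule powr_mono2)
    have "(real m + 2 * \<nu>) / (real n + 2 * \<nu>) \<le> (real m + 2 * \<nu>) / real n"
      using nu m by (intro divide_left_mono) auto
    also have "\<dots> \<le> (real m + 2 * \<nu> * real m) / real n"
      using nu m by (intro divide_right_mono) auto
    finally show "(real m + 2 * \<nu>) / (real n + 2 * \<nu>) \<le> (1 + 2 * \<nu>) * (real m / real n)"
      by (simp add: algebra_simps add_divide_distrib)
  qed (use nu in auto)
  finally show ?thesis .
qed

section \<open>Decay of normalised solutions\<close>

text \<open>\<open>rec\<close> is the monic recurrence after division by the ultraspherical value at
  1. The initial bounds admit both \<open>(u 0, u 1) = (1, x)\<close> and
  \<open>(0, 1)\<close>.\<close>

locale ultra_solution =
  fixes \<nu> x :: real and u :: "nat \<Rightarrow> real"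
  assumes nu: "\<nu> > 1/2" and x: "\<bar>x\<bar> \<le> 1"
    and rec: "\<And>n. (real n + 1 + 2 * \<nu>) * u (Suc (Suc n)) =
                  2 * (real n + 1 + \<nu>) * x * u (Suc n) - (real n + 1) * u n"
    and init: "\<bar>u 0\<bar> \<le> 1" "\<bar>x * u 0 - u 1\<bar> \<le> 1"
begin

definition e where "e n = x * u n - u (Suc n)"
definition s where "s = sqrt (1 - x\<^sup>2)"

lemma s: "s \<ge> 0" "s\<^sup>2 = 1 - x\<^sup>2" "s \<le> 1"
  using x by (auto simp: s_def abs_square_le_1)

lemma u_Suc: "u (Suc n) = x * u n - e n"
  by (simp add: e_def)

text \<open>Since \<open>2 * (n + 1 + \<nu>) = (n + 1 + 2 * \<nu>) + (n + 1)\<close>, the recurrence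
  leaves a common factor below 1, the source of the damping.\<close>

lemma e_Suc: "e (Suc n) = (real n + 1) / (real n + 1 + 2 * \<nu>) * (s\<^sup>2 * u n + x * e n)"
proof -
  have "(real n + 1 + 2 * \<nu>) * e (Suc n) = (real n + 1) * (s\<^sup>2 * u n + x * e n)"
    unfolding e_def s(2) right_diff_distrib rec by (simp add: algebra_simps power2_eq_square)
  then show ?thesis using nu by (simp add: field_simps)
qed

section \<open>Boundedness in the range \<open>n * s \<le> 1\<close>\<close>

text \<open>Half of \<open>M\<close> covers the initial data and the damping sum, the other half the
  driven part of \<open>u\<close>.\<close>

definition M :: real where "M = 2 * (1 + 2 * \<nu> / (2 * \<nu> - 1))"

lemma M_eq: "M / 2 = 1 + 2 * \<nu> / (2 * \<nu> - 1)" by (simp add: M_def)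

lemma M_ge: "M \<ge> 2" using nu by (simp add: M_def)

text \<open>A joint induction: the bound \<open>M\<close> on \<open>u n\<close> controls the driving
  term of \<open>e\<close>, summing \<open>e\<close> bounds \<open>u\<close>, and
  \<open>(n * s)\<^sup>2 \<le> 1\<close> returns \<open>M\<close>.\<close>

lemma small_bounds:
  assumes "real n * s \<le> 1"
  shows "\<bar>e n\<bar> \<le> damping \<nu> n + s\<^sup>2 * M * real n / (2 * \<nu> + 1) \<and>
    \<bar>u n\<bar> \<le> 1 + (\<Sum>k<n. damping \<nu> k) + s\<^sup>2 * M * (real n)\<^sup>2 / (2 * (2 * \<nu> + 1)) \<and>
    \<bar>u n\<bar> \<le> M"
  using assms
proof (induction n)
  case 0
  then show ?case using init M_ge by (simp add: e_def)
next
  case (Suc n)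
  have "real n * s \<le> 1"
    using s(1) Suc.prems by (simp add: algebra_simps)
  from Suc.IH[OF this] have IH: "\<bar>e n\<bar> \<le> damping \<nu> n + s\<^sup>2 * M * real n / (2 * \<nu> + 1)"
    "\<bar>u n\<bar> \<le> 1 + (\<Sum>k<n. damping \<nu> k) + s\<^sup>2 * M * (real n)\<^sup>2 / (2 * (2 * \<nu> + 1))"
    "\<bar>u n\<bar> \<le> M" by auto
  have xz: "\<bar>x * z\<bar> \<le> \<bar>z\<bar>" for z
    using x by (simp add: abs_mult mult_left_le_one_le)
  have es: "\<bar>s\<^sup>2 * u n + x * e n\<bar> \<le> s\<^sup>2 * M + (damping \<nu> n + s\<^sup>2 * M * real n / (2 * \<nu> + 1))"
  proof -
    have "\<bar>s\<^sup>2 * u n\<bar> \<le> s\<^sup>2 * M" using IH(3) by (simp add: abs_mult mult_left_mono)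
    with xz[of "e n"] IH(1) show ?thesis by linarith
  qed
  have eS: "\<bar>e (Suc n)\<bar> \<le> damping \<nu> (Suc n) + s\<^sup>2 * M * real (Suc n) / (2 * \<nu> + 1)"
  proof -
    have "\<bar>e (Suc n)\<bar> = (real n + 1) / (real n + 1 + 2 * \<nu>) * \<bar>s\<^sup>2 * u n + x * e n\<bar>"
      using nu by (simp add: e_Suc abs_mult)
    also have "\<dots> \<le> (real n + 1) / (real n + 1 + 2 * \<nu>) *
        (s\<^sup>2 * M + (damping \<nu> n + s\<^sup>2 * M * real n / (2 * \<nu> + 1)))"
      using es nu by (intro mult_left_mono) auto
    also have "\<dots> = damping \<nu> (Suc n) + (real n + 1) / (real n + 1 + 2 * \<nu>) *
        (s\<^sup>2 * M + s\<^sup>2 * M * real n / (2 * \<nu> + 1))"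
      by (simp add: damping_Suc algebra_simps)
    \<comment> \<open>The slope \<open>1 / (2 * \<nu> + 1)\<close> is the one that the recursion for
      \<open>e\<close> reproduces exactly.\<close>
    also have "(real n + 1) / (real n + 1 + 2 * \<nu>) * (s\<^sup>2 * M + s\<^sup>2 * M * real n / (2 * \<nu> + 1))
        = s\<^sup>2 * M * real (Suc n) / (2 * \<nu> + 1)"
    proof -
      have "s\<^sup>2 * M + s\<^sup>2 * M * real n / (2 * \<nu> + 1) = s\<^sup>2 * M * (real n + 1 + 2 * \<nu>) / (2 * \<nu> + 1)"
        using nu by (simp add: field_simps)
      then show ?thesis using nu by simp
    qed
    finally show ?thesis .
  qed
  have u: "\<bar>u (Suc n)\<bar> \<le> 1 + (\<Sum>k<Suc n. damping \<nu> k) + s\<^sup>2 * M * (real (Suc n))\<^sup>2 / (2 * (2 * \<nu> + 1))"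
  proof -
    have "\<bar>u (Suc n)\<bar> \<le> \<bar>u n\<bar> + \<bar>e n\<bar>" unfolding u_Suc using xz[of "u n"] by linarith
    moreover have "s\<^sup>2 * M * (real n)\<^sup>2 / (2 * (2 * \<nu> + 1)) + s\<^sup>2 * M * real n / (2 * \<nu> + 1)
       \<le> s\<^sup>2 * M * (real (Suc n))\<^sup>2 / (2 * (2 * \<nu> + 1))"
    proof -
      have "s\<^sup>2 * M * (real n)\<^sup>2 / (2 * (2 * \<nu> + 1)) + s\<^sup>2 * M * real n / (2 * \<nu> + 1)
          = s\<^sup>2 * M * ((real n)\<^sup>2 + 2 * real n) / (2 * (2 * \<nu> + 1))"
        unfolding distrib_left[of "s\<^sup>2 * M"] add_divide_distrib
        using nu by (simp add: divide_simps) (simp add: algebra_simps)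
      also have "\<dots> \<le> s\<^sup>2 * M * (real (Suc n))\<^sup>2 / (2 * (2 * \<nu> + 1))"
        using nu M_ge by (intro divide_right_mono mult_left_mono) (auto simp: power2_eq_square algebra_simps)
      finally show ?thesis .
    qed
    ultimately show ?thesis using IH(1,2) by simp
  qed
  have "(real (Suc n) * s)\<^sup>2 \<le> 1"
    using Suc.prems s(1) by (intro power_le_one) auto
  then have "M * (s\<^sup>2 * (real (Suc n))\<^sup>2) \<le> M * 1"
    using M_ge by (intro mult_left_mono) (auto simp: power_mult_distrib mult.commute)
  then have "s\<^sup>2 * M * (real (Suc n))\<^sup>2 / (2 * (2 * \<nu> + 1)) \<le> M / (2 * (2 * \<nu> + 1))"
    using nu by (intro divide_right_mono) (auto simp: mult_ac)
  also have "\<dots> \<le> M / 2"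
    using nu M_ge by (intro divide_left_mono) auto
  finally have "\<bar>u (Suc n)\<bar> \<le> M"
    using u sum_damping_less[OF nu, of "Suc n"] M_eq by linarith
  with eS u show ?case by blast
qed

section \<open>Energy bound in the range \<open>n * s \<ge> 1\<close>\<close>

definition M2 :: real where "M2 = 2 * M + 2 * \<nu>"

lemma M2_ge: "M2 \<ge> M" "M2 \<ge> 1" using M_ge nu by (auto simp: M2_def)

text \<open>The step from \<open>(s u\<^sub>n, e\<^sub>n)\<close> to \<open>(s u\<^sub>n\<^sub>+\<^sub>1, e\<^sub>n\<^sub>+\<^sub>1)\<close> is a rotation followed by a contraction of
  the second component.\<close>

lemma energy_Suc: "s\<^sup>2 * (u (Suc n))\<^sup>2 + (e (Suc n))\<^sup>2 \<le> s\<^sup>2 * (u n)\<^sup>2 + (e n)\<^sup>2"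
proof -
  define r where "r = (real n + 1) / (real n + 1 + 2 * \<nu>)"
  have r: "0 \<le> r" "r \<le> 1" using nu by (auto simp: r_def)
  have "(e (Suc n))\<^sup>2 = r\<^sup>2 * (s\<^sup>2 * u n + x * e n)\<^sup>2"
    by (simp only: e_Suc r_def power_mult_distrib)
  also have "\<dots> \<le> (s\<^sup>2 * u n + x * e n)\<^sup>2"
    using r by (intro mult_left_le_one_le) (auto intro: power_le_one)
  finally have "s\<^sup>2 * (u (Suc n))\<^sup>2 + (e (Suc n))\<^sup>2 \<le> s\<^sup>2 * (x * u n - e n)\<^sup>2 + (s\<^sup>2 * u n + x * e n)\<^sup>2"
    by (simp add: u_Suc)
  also have "\<dots> = (s\<^sup>2 + x\<^sup>2) * (s\<^sup>2 * (u n)\<^sup>2 + (e n)\<^sup>2)"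
    by (simp add: power2_eq_square algebra_simps)
  finally show ?thesis by (simp add: s(2))
qed

text \<open>The energy is nonincreasing, so it is enough that both components are O(s) at the last
  index covered by \<open>small_bounds\<close>.\<close>

lemma energy_bound:
  assumes "real n * s \<ge> 1"
  shows "s\<^sup>2 * (u n)\<^sup>2 + (e n)\<^sup>2 \<le> (s * M2)\<^sup>2"
proof -
  have s0: "s > 0" using assms s(1) by (cases "s = 0") auto
  define m where "m = nat \<lfloor>1 / s\<rfloor>"
  have m: "real m \<le> 1 / s" "1 / s < real m + 1"
    using s0 by (auto simp: m_def)
  have ms: "real m * s \<le> 1" "1 < (real m + 1) * s" using m s0 by (auto simp: field_simps)
  have "m \<le> n"
  proof -
    have "1 / s \<le> real n" using assms s0 by (simp add: field_simps)
    with m(1) have "real m \<le> real n" by linarith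
    then show ?thesis by simp
  qed
  have em: "\<bar>e m\<bar> \<le> s * (2 * \<nu> + M / 2)"
  proof -
    have "damping \<nu> m \<le> 2 * \<nu> / (real m + 2 * \<nu>)" by (rule damping_le[OF nu])
    \<comment> \<open>Here \<open>m + 2 * \<nu> > m + 1 > 1 / s\<close>.\<close>
    also have "\<dots> \<le> 2 * \<nu> / (1 / s)"
      using m nu s0 by (intro divide_left_mono) auto
    finally have 1: "damping \<nu> m \<le> s * (2 * \<nu>)" by (simp add: mult.commute)
    have "s\<^sup>2 * M * real m / (2 * \<nu> + 1) = (s * M) * (real m * s) / (2 * \<nu> + 1)"
      by (simp add: power2_eq_square)
    also have "\<dots> \<le> (s * M) * 1 / 2"
      using nu ms M_ge s0 by (intro frac_le mult_left_mono) auto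
    finally show ?thesis
      using conjunct1[OF small_bounds[OF ms(1)]] 1 unfolding distrib_left by linarith
  qed
  have "s\<^sup>2 * (u n)\<^sup>2 + (e n)\<^sup>2 \<le> s\<^sup>2 * (u m)\<^sup>2 + (e m)\<^sup>2"
    using \<open>m \<le> n\<close> energy_Suc by (rule lift_Suc_antimono_le[of "\<lambda>n. s\<^sup>2 * (u n)\<^sup>2 + (e n)\<^sup>2", rotated])
  also have "\<dots> \<le> s\<^sup>2 * M\<^sup>2 + (s * (2 * \<nu> + M / 2))\<^sup>2"
  proof (intro add_mono mult_left_mono)
    show "(u m)\<^sup>2 \<le> M\<^sup>2" using small_bounds[OF ms(1)] M_ge by (simp add: abs_le_square_iff[symmetric])
    show "(e m)\<^sup>2 \<le> (s * (2 * \<nu> + M / 2))\<^sup>2" 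
      using em s0 M_ge nu by (simp add: abs_le_square_iff[symmetric] abs_mult)
  qed auto
  also have "\<dots> \<le> (s * M2)\<^sup>2"
  proof -
    have "M\<^sup>2 + (2 * \<nu> + M / 2)\<^sup>2 \<le> M2\<^sup>2"
      using M_ge nu by (auto simp: M2_def power2_eq_square algebra_simps)
    from mult_left_mono[OF this, of "s\<^sup>2"] show ?thesis

      by (simp add: power_mult_distrib distrib_left[of "s\<^sup>2"])
  qed
  finally show ?thesis .
qed

lemma e_bound:
  assumes "real n * s \<ge> 1"
  shows "\<bar>e n\<bar> \<le> s * M2"
proof -
  have "0 \<le> s\<^sup>2 * (u n)\<^sup>2" by simp
  with energy_bound[OF assms] have "(e n)\<^sup>2 \<le> (s * M2)\<^sup>2" by linarith
  then show ?thesis using s(1) M2_ge by (simp add: abs_le_square_iff[symmetric] abs_mult)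
qed

lemma u_bound: "\<bar>u n\<bar> \<le> M2"
proof (cases "real n * s \<le> 1")
  case True
  then show ?thesis using small_bounds[of n] M2_ge(1) by fastforce
next
  case False
  then have s0: "s > 0" using s(1) by (cases "s = 0") auto
  have "s\<^sup>2 * (u n)\<^sup>2 \<le> (s * M2)\<^sup>2"
    using energy_bound[of n] False zero_le_power2[of "e n"] by linarith
  then have "(u n)\<^sup>2 \<le> M2\<^sup>2" using s0 by (simp add: power_mult_distrib)
  then show ?thesis using M2_ge by (simp add: abs_le_square_iff[symmetric])
qed


section \<open>The Turan form: increments, definiteness and growth\<close>

text \<open>With \<open>h\<close> as below, \<open>h n * turan n\<close> is the form \<open>p\<^sub>n\<^sup>2 - (x / a\<^sub>n\<^sub>+\<^sub>1) p\<^sub>n p\<^sub>n\<^sub>+\<^sub>1 + p\<^sub>n\<^sub>+\<^sub>1\<^sup>2\<close>, up to a constant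
  factor, for the corresponding solution \<open>p\<^sub>n\<close> of the orthonormal recurrence with \<open>a\<^sub>n\<^sup>2 = \<beta>\<^sub>n\<close>; its
  increment is proportional to \<open>\<beta>\<^sub>n\<^sub>+\<^sub>2 - \<beta>\<^sub>n\<^sub>+\<^sub>1\<close>.\<close>

definition A where "A n = (real n + 1 + \<nu>) / (real n + 1)"
definition B where "B n = (real n + 2 * \<nu>) / (real n + \<nu>)"
definition turan where
  "turan n = (u n)\<^sup>2 - 2 * x * A n * u n * u (Suc n) + A n * B n * (u (Suc n))\<^sup>2"
definition h where "h n = (real n + \<nu>) / ((real n + 2 * \<nu>) * damping \<nu> n)"

lemma h_pos: "h n > 0"
  using nu damping_pos[of \<nu> n] by (auto simp: h_def intro!: divide_pos_pos mult_pos_pos)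

text \<open>The growth factor of \<open>h\<close> is the coefficient of
  \<open>(u (Suc n))\<^sup>2\<close> in \<open>turan n\<close>, so these squares cancel in
  \<open>turan_diff\<close>.\<close>

lemma h_Suc: "h (Suc n) = h n * (A n * B n)"
proof -
  have "damping \<nu> n > 0" using nu damping_pos by auto
  then show ?thesis using nu
    by (simp add: h_def A_def B_def damping_Suc divide_simps) (simp add: algebra_simps)
qed

text \<open>Replacing \<open>2 * x * u (Suc n)\<close> by the recurrence removes \<open>x\<close>
  and expresses consecutive forms through the same two products.\<close>

lemma turan_alt:
  "turan n = A n * B n * (u (Suc n))\<^sup>2 - (real n + 1 + 2 * \<nu>) / (real n + 1) * (u n * u (Suc (Suc n)))"
  "turan (Suc n) = (u (Suc n))\<^sup>2 - A (Suc n) * (real n + 1) / (real n + 1 + \<nu>) * (u n * u (Suc (Suc n)))"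
proof -
  have r: "2 * x * u (Suc n) = ((real n + 1 + 2 * \<nu>) * u (Suc (Suc n)) + (real n + 1) * u n) / (real n + 1 + \<nu>)"
    using rec[of n] nu by (simp add: field_simps)
  have "2 * x * A n * u n * u (Suc n) = A n * u n * (2 * x * u (Suc n))" by simp
  also have "\<dots> = (real n + 1 + 2 * \<nu>) / (real n + 1) * (u n * u (Suc (Suc n))) + (u n)\<^sup>2"
    unfolding r using nu by (simp add: A_def divide_simps) (simp add: algebra_simps power2_eq_square)
  finally show "turan n = A n * B n * (u (Suc n))\<^sup>2 - (real n + 1 + 2 * \<nu>) / (real n + 1) * (u n * u (Suc (Suc n)))"
    by (simp add: turan_def)
  have "2 * x * A (Suc n) * u (Suc n) * u (Suc (Suc n)) = A (Suc n) * u (Suc (Suc n)) * (2 * x * u (Suc n))"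
    by simp
  also have "\<dots> = A (Suc n) * ((real n + 1 + 2 * \<nu>) / (real n + 1 + \<nu>) * (u (Suc (Suc n)))\<^sup>2
      + (real n + 1) / (real n + 1 + \<nu>) * (u n * u (Suc (Suc n))))"
    unfolding r using nu by (simp add: divide_simps) (simp add: algebra_simps power2_eq_square)
  also have "(real n + 1 + 2 * \<nu>) / (real n + 1 + \<nu>) = B (Suc n)"
    by (simp add: B_def add_ac)
  finally show "turan (Suc n) = (u (Suc n))\<^sup>2 - A (Suc n) * (real n + 1) / (real n + 1 + \<nu>) * (u n * u (Suc (Suc n)))"
    by (simp add: turan_def algebra_simps)
qed

lemma turan_diff:
  "h (Suc n) * turan (Suc n) - h n * turan n =
     h n * (u n * u (Suc (Suc n))) * (2 * \<nu> * (\<nu> - 1) / ((real n + 1) * (real n + 2) * (real n + \<nu>)))"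
proof -
  have c: "(real n + 1 + 2 * \<nu>) / (real n + 1) - A n * B n * (A (Suc n) * (real n + 1) / (real n + 1 + \<nu>))
      = 2 * \<nu> * (\<nu> - 1) / ((real n + 1) * (real n + 2) * (real n + \<nu>))"
    using nu by (simp add: A_def B_def divide_simps) (simp add: algebra_simps power2_eq_square)
  have "h (Suc n) * turan (Suc n) - h n * turan n = h n * (u n * u (Suc (Suc n))) *
    ((real n + 1 + 2 * \<nu>) / (real n + 1) - A n * B n * (A (Suc n) * (real n + 1) / (real n + 1 + \<nu>)))"
    unfolding h_Suc turan_alt(1)[of n] turan_alt(2)[of n] by (simp add: algebra_simps)
  then show ?thesis unfolding c .
qed

lemma AB_bounds: "A n \<ge> 1" "B n \<ge> 0" "A n * B n \<le> 2 * (1 + \<nu>)"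
proof -
  show "A n \<ge> 1" "B n \<ge> 0" using nu by (auto simp: A_def B_def)
  have "A n \<le> 1 + \<nu>" "B n \<le> 2" using nu by (auto simp: A_def B_def field_simps)
  then have "A n * B n \<le> (1 + \<nu>) * 2"
    using \<open>A n \<ge> 1\<close> \<open>B n \<ge> 0\<close> nu by (intro mult_mono) auto
  then show "A n * B n \<le> 2 * (1 + \<nu>)" by simp
qed

text \<open>The determinant of the form is at least of order \<open>s\<^sup>2\<close>, because
  \<open>A n - B n\<close> is only O(1/n^2) and \<open>n * s\<close> is large. Completing the square
  in either variable then gives the two bounds.\<close>

lemma turan_definite:
  assumes ns: "real n * s \<ge> 1 + 2 * \<nu>"
  shows "s\<^sup>2 * (u (Suc n))\<^sup>2 \<le> 2 * turan n" "s\<^sup>2 * (u n)\<^sup>2 \<le> 4 * (1 + \<nu>) * turan n"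
proof -
  have n: "n > 0" using ns nu by (cases n) auto
  have "(1 + 2 * \<nu>)\<^sup>2 \<le> (real n * s)\<^sup>2" using ns nu by (intro power_mono) auto
  moreover have "2 * \<nu> * (\<nu> - 1) \<le> (1 + 2 * \<nu>)\<^sup>2" using nu by (auto simp: power2_eq_square algebra_simps)
  ultimately have k: "2 * \<nu> * (\<nu> - 1) \<le> (real n)\<^sup>2 * s\<^sup>2" by (simp add: power_mult_distrib)
  have "(real n)\<^sup>2 * s\<^sup>2 \<le> ((real n + \<nu>) * (real n + 1)) * s\<^sup>2"
    using nu by (intro mult_right_mono) (auto simp: power2_eq_square algebra_simps)
  with k have "\<nu> * (\<nu> - 1) / ((real n + \<nu>) * (real n + 1)) \<le> s\<^sup>2 / 2"
    using nu by (simp add: pos_divide_le_eq mult_ac)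
  moreover have "A n - B n = \<nu> * (\<nu> - 1) / ((real n + \<nu>) * (real n + 1))"
    using nu n by (simp add: A_def B_def divide_simps) (simp add: algebra_simps power2_eq_square)
  ultimately have AB: "A n - B n \<le> s\<^sup>2 / 2" by simp
  \<comment> \<open>The determinant of \<open>turan n\<close> as a quadratic form in
    \<open>u n\<close> and \<open>u (Suc n)\<close>.\<close>
  define d where "d = A n * B n - (x * A n)\<^sup>2"
  have "d = A n * (s\<^sup>2 * A n - (A n - B n))"
    by (simp add: d_def s(2)) (simp add: power2_eq_square algebra_simps)
  moreover have "s\<^sup>2 * A n - (A n - B n) \<ge> s\<^sup>2 / 2"
    using AB mult_left_mono[OF AB_bounds(1)[of n], of "s\<^sup>2"] by simp
  ultimately have d: "d \<ge> s\<^sup>2 / 2"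
    using AB_bounds(1)[of n] 
    by (smt (verit) mult_le_cancel_right1 zero_le_power2 half_gt_zero_iff divide_nonneg_nonneg)
  have "turan n = (u n - x * A n * u (Suc n))\<^sup>2 + d * (u (Suc n))\<^sup>2"
    by (simp add: turan_def d_def power2_eq_square algebra_simps)
  then have "d * (u (Suc n))\<^sup>2 \<le> turan n" by simp
  with mult_right_mono[OF d, of "(u (Suc n))\<^sup>2"] show 1: "s\<^sup>2 * (u (Suc n))\<^sup>2 \<le> 2 * turan n"
    by simp
  then have t0: "turan n \<ge> 0" using zero_le_mult_iff[of "s\<^sup>2"] by (smt (verit) zero_le_power2 mult_nonneg_nonneg)
  \<comment> \<open>Multiplying by the leading coefficient completes the square in
    \<open>u (Suc n)\<close> instead of \<open>u n\<close>.\<close>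
  have "A n * B n * turan n = (A n * B n * u (Suc n) - x * A n * u n)\<^sup>2 + d * (u n)\<^sup>2"
    by (simp add: turan_def d_def power2_eq_square algebra_simps)
  then have "d * (u n)\<^sup>2 \<le> A n * B n * turan n" by simp
  also have "\<dots> \<le> 2 * (1 + \<nu>) * turan n" using AB_bounds(3) t0 by (intro mult_right_mono)
  finally have "d * (u n)\<^sup>2 \<le> 2 * (1 + \<nu>) * turan n" .
  with mult_right_mono[OF d, of "(u n)\<^sup>2"] show "s\<^sup>2 * (u n)\<^sup>2 \<le> 4 * (1 + \<nu>) * turan n"
    by (simp add: algebra_simps)
qed

text \<open>\<open>2 * \<nu> * (\<nu> + 1)\<close> bounds the coefficient in
  \<open>turan_diff\<close>; \<open>10 + 8 * \<nu>\<close> bounds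
  \<open>s\<^sup>2 * \<bar>u n * u (n + 2)\<bar>\<close> relative to \<open>turan n\<close>.\<close>

definition D :: real where "D = 2 * \<nu> * (\<nu> + 1) * (10 + 8 * \<nu>)"

lemma D_nonneg: "D \<ge> 0" using nu by (simp add: D_def)

text \<open>By \<open>turan_definite\<close>, the form itself dominates the product
  \<open>u n * u (n + 2)\<close> in its increment, which turns the absolute error into a relative
  one.\<close>

lemma turan_Suc_le:
  assumes ns: "real n * s \<ge> 1 + 2 * \<nu>"
  shows "h (Suc n) * turan (Suc n) \<le> h n * turan n * (1 + D / (s\<^sup>2 * real n ^ 3))"
proof -
  have n: "n > 0" and s0: "s > 0" using ns nu s(1) by (cases n; cases "s = 0"; force)+
  let ?u2 = "u (Suc (Suc n))" and ?c = "2 * \<nu> * (\<nu> - 1) / ((real n + 1) * (real n + 2) * (real n + \<nu>))"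
  have t0: "turan n \<ge> 0" 
    using turan_definite(1)[OF ns] by (smt (verit) zero_le_power2 mult_nonneg_nonneg)
  have "\<bar>?u2\<bar> \<le> 2 * \<bar>u (Suc n)\<bar> + \<bar>u n\<bar>"
  proof -
    have "(real n + 1 + 2 * \<nu>) * \<bar>?u2\<bar> = \<bar>2 * (real n + 1 + \<nu>) * x * u (Suc n) - (real n + 1) * u n\<bar>"
      using nu by (simp only: rec[symmetric] abs_mult)
    also have "\<dots> \<le> \<bar>2 * (real n + 1 + \<nu>) * x * u (Suc n)\<bar> + \<bar>(real n + 1) * u n\<bar>" by simp
    also have "\<dots> = 2 * (real n + 1 + \<nu>) * (\<bar>x\<bar> * \<bar>u (Suc n)\<bar>) + (real n + 1) * \<bar>u n\<bar>"
      using nu by (simp add: abs_mult)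
    also have "\<dots> \<le> 2 * (real n + 1 + 2 * \<nu>) * (1 * \<bar>u (Suc n)\<bar>) + (real n + 1 + 2 * \<nu>) * \<bar>u n\<bar>"
      using nu x by (intro add_mono mult_mono mult_nonneg_nonneg) auto
    finally have "(real n + 1 + 2 * \<nu>) * \<bar>?u2\<bar> \<le> (real n + 1 + 2 * \<nu>) * (2 * \<bar>u (Suc n)\<bar> + \<bar>u n\<bar>)"
      by (simp add: algebra_simps)
    then show ?thesis using nu by simp
  qed
  then have "\<bar>u n\<bar> * \<bar>?u2\<bar> \<le> \<bar>u n\<bar> * (2 * \<bar>u (Suc n)\<bar> + \<bar>u n\<bar>)"
    by (intro mult_left_mono) auto
  also have "\<dots> \<le> 2 * (u n)\<^sup>2 + (u (Suc n))\<^sup>2"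
    using zero_le_power2[of "\<bar>u n\<bar> - \<bar>u (Suc n)\<bar>"] by (simp add: power2_diff) (simp add: power2_eq_square algebra_simps)
  finally have "s\<^sup>2 * (\<bar>u n\<bar> * \<bar>?u2\<bar>) \<le> s\<^sup>2 * (2 * (u n)\<^sup>2 + (u (Suc n))\<^sup>2)"
    by (intro mult_left_mono) auto
  \<comment> \<open>Twice the second bound plus the first:
    \<open>2 * 4 * (1 + \<nu>) + 2\<close>.\<close>
  also have "\<dots> \<le> (10 + 8 * \<nu>) * turan n"
    using turan_definite[OF ns] by (simp add: algebra_simps)
  finally have uu: "\<bar>u n * ?u2\<bar> \<le> (10 + 8 * \<nu>) * turan n / s\<^sup>2"
    using s0 by (simp add: abs_mult field_simps)
  have c: "\<bar>?c\<bar> \<le> 2 * \<nu> * (\<nu> + 1) / real n ^ 3"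
  proof -
    have "\<bar>?c\<bar> = 2 * \<nu> * \<bar>\<nu> - 1\<bar> / ((real n + 1) * (real n + 2) * (real n + \<nu>))"
      using nu by (simp add: abs_mult)
    also have "\<dots> \<le> 2 * \<nu> * (\<nu> + 1) / (real n * real n * real n)"
      using nu n by (intro frac_le mult_mono) auto
    finally show ?thesis by (simp add: power3_eq_cube)
  qed
  have "h (Suc n) * turan (Suc n) - h n * turan n = h n * ((u n * ?u2) * ?c)"
    by (simp only: turan_diff mult.assoc)
  also have "\<dots> \<le> h n * (\<bar>u n * ?u2\<bar> * \<bar>?c\<bar>)"
    using h_pos[of n] unfolding abs_mult[symmetric] by (intro mult_left_mono abs_ge_self) auto
  also have "\<dots> \<le> h n * (((10 + 8 * \<nu>) * turan n / s\<^sup>2) * (2 * \<nu> * (\<nu> + 1) / real n ^ 3))"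
    using h_pos[of n] uu c t0 nu by (intro mult_left_mono mult_mono) auto
  also have "\<dots> = h n * turan n * (D / (s\<^sup>2 * real n ^ 3))"
    by (simp add: D_def)
  finally show ?thesis by (simp add: algebra_simps)
qed

text \<open>A discrete Gronwall argument: the weight \<open>?E\<close> absorbs each factor
  \<open>1 + D / (s\<^sup>2 * k ^ 3)\<close>, since \<open>1 / k ^ 3\<close> is at most the
  decrement of \<open>2 / k\<^sup>2\<close>.\<close>

lemma turan_growth:
  assumes ms: "real m * s \<ge> 1 + 2 * \<nu>" and mn: "m \<le> n"
  shows "h n * turan n \<le> h m * turan m * exp (2 * D)"
proof -
  have m: "m > 0" and s0: "s > 0" using ms nu s(1) by (cases m; cases "s = 0"; force)+
  let ?E = "\<lambda>n. exp (2 * D / (s\<^sup>2 * (real n)\<^sup>2))"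
  have nonneg: "h k * turan k \<ge> 0" if "m \<le> k" for k
  proof -
    have "real m * s \<le> real k * s" using that s0 by (intro mult_right_mono) auto
    with ms have "real k * s \<ge> 1 + 2 * \<nu>" by linarith
    from turan_definite(1)[OF this] have "turan k \<ge> 0" by (smt (verit) zero_le_power2 mult_nonneg_nonneg)
    with h_pos[of k] show ?thesis by simp
  qed
  have "h n * turan n * ?E n \<le> h m * turan m * ?E m"
    using mn
  proof (induction n rule: dec_induct)
    case (step k)
    have "real m * s \<le> real k * s" using step s0 by (intro mult_right_mono) auto
    with ms have ks: "real k * s \<ge> 1 + 2 * \<nu>" by linarith
    have k: "real k \<ge> 1" using m step by simp
    have "1 / real k ^ 3 \<le> 2 / (real k)\<^sup>2 - 2 / (real (Suc k))\<^sup>2"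
    proof -
      have *: "2 / (real k)\<^sup>2 - 2 / (real (Suc k))\<^sup>2 = (4 * real k + 2) / ((real k)\<^sup>2 * (real k + 1)\<^sup>2)"
        using k by (simp add: divide_simps) (simp add: algebra_simps power2_eq_square)
      have "(real k + 1)\<^sup>2 \<le> (4 * real k + 2) * real k"
        using k mult_mono[OF k k] by (simp add: power2_eq_square algebra_simps)
      then show ?thesis unfolding * using k
        by (simp add: divide_simps power2_eq_square power3_eq_cube)
    qed
    then have "D / s\<^sup>2 * (1 / real k ^ 3) \<le> D / s\<^sup>2 * (2 / (real k)\<^sup>2 - 2 / (real (Suc k))\<^sup>2)"
      using D_nonneg by (intro mult_left_mono) auto
    then have le: "D / (s\<^sup>2 * real k ^ 3) + 2 * D / (s\<^sup>2 * (real (Suc k))\<^sup>2) \<le> 2 * D / (s\<^sup>2 * (real k)\<^sup>2)"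
      by (simp add: right_diff_distrib mult.commute)
    have "h (Suc k) * turan (Suc k) * ?E (Suc k) \<le> h k * turan k * (1 + D / (s\<^sup>2 * real k ^ 3)) * ?E (Suc k)"
      using turan_Suc_le[OF ks] by (intro mult_right_mono) auto
    also have "\<dots> \<le> h k * turan k * exp (D / (s\<^sup>2 * real k ^ 3)) * ?E (Suc k)"
      using nonneg[of k] step by (intro mult_right_mono mult_left_mono exp_ge_add_one_self) auto
    also have "\<dots> = h k * turan k * exp (D / (s\<^sup>2 * real k ^ 3) + 2 * D / (s\<^sup>2 * (real (Suc k))\<^sup>2))"
      by (simp only: exp_add mult.assoc)
    also have "\<dots> \<le> h k * turan k * ?E k"
      using nonneg[of k] step le by (intro mult_left_mono) auto
    also have "\<dots> \<le> h m * turan m * ?E m" by (rule step.IH)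
    finally show ?case .
  qed simp
  moreover have "h n * turan n * 1 \<le> h n * turan n * ?E n"
    using nonneg[OF mn] D_nonneg by (intro mult_left_mono) auto
  moreover have "h m * turan m * ?E m \<le> h m * turan m * exp (2 * D)"
  proof (intro mult_left_mono)
    have "1 \<le> (real m * s)\<^sup>2" using ms nu by (intro one_le_power) auto
    then have "2 * D / (s\<^sup>2 * (real m)\<^sup>2) \<le> 2 * D / 1"
      using D_nonneg m s0 by (intro divide_left_mono) (auto simp: power_mult_distrib mult.commute)
    then show "?E m \<le> exp (2 * D)" by simp
  qed (use nonneg in auto)
  ultimately show ?thesis by simp
qed

text \<open>The form is the energy plus two corrections with coefficients O(1/m) and O(1/m^2); as
  \<open>1 / m \<le> s\<close>, everything is O(s^2).\<close>

lemma turan_upper: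
  assumes "real m * s \<ge> 1"
  shows "turan m \<le> (1 + 3 * \<nu>) * M2\<^sup>2 * s\<^sup>2"
proof -
  have m: "m > 0" and s0: "s > 0" using assms s(1) by (cases m; cases "s = 0"; force)+
  have 1: "1 / (real m + 1) \<le> s" "1 / (real m + \<nu>) \<le> s"
    using assms s0 nu m by (auto simp: field_simps intro: order_trans[OF assms])
  have "turan m = (s\<^sup>2 * (u m)\<^sup>2 + (e m)\<^sup>2) - 2 * \<nu> / (real m + 1) * (u (Suc m) * e m)
      + \<nu> * (1 / (real m + 1) * (1 / (real m + \<nu>)) * (u (Suc m))\<^sup>2)"
  proof -
    have a: "A m = 1 + \<nu> / (real m + 1)" using nu by (simp add: A_def field_simps)
    have ab: "A m * B m = 1 + 2 * \<nu> / (real m + 1) + \<nu> * (1 / (real m + 1) * (1 / (real m + \<nu>)))"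
      using nu m by (simp add: A_def B_def divide_simps) (simp add: algebra_simps)
    show ?thesis unfolding turan_def ab unfolding a e_def s(2)
      by (simp add: algebra_simps power2_eq_square)
  qed
  moreover have "- (2 * \<nu> / (real m + 1) * (u (Suc m) * e m)) \<le> 2 * \<nu> * M2\<^sup>2 * s\<^sup>2"
  proof -
    have "- (2 * \<nu> / (real m + 1) * (u (Suc m) * e m)) \<le> \<bar>2 * \<nu> / (real m + 1) * (u (Suc m) * e m)\<bar>"
      by (rule abs_ge_minus_self)
    also have "\<dots> = 2 * \<nu> * (1 / (real m + 1) * (\<bar>u (Suc m)\<bar> * \<bar>e m\<bar>))"
      using nu by (simp add: abs_mult)
    also have "\<dots> \<le> 2 * \<nu> * (s * (M2 * (s * M2)))"
      using 1 u_bound e_bound[OF assms] nu s0 M2_ge by (intro mult_left_mono mult_mono) auto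
    finally show ?thesis by (simp add: power2_eq_square mult_ac)
  qed
  moreover have "\<nu> * (1 / (real m + 1) * (1 / (real m + \<nu>)) * (u (Suc m))\<^sup>2) \<le> \<nu> * (s * s * M2\<^sup>2)"
    using 1 u_bound nu s0 M2_ge
    by (intro mult_left_mono mult_mono) (auto simp: abs_le_square_iff[symmetric])
  ultimately show ?thesis using energy_bound[OF assms]
    by (simp add: algebra_simps power2_eq_square)
qed

text \<open>\<open>h\<close> equals \<open>1 / damping\<close> up to a factor between 1/2 and
  1.\<close>

lemma h_ratio:
  assumes "1 \<le> m" "m \<le> n"
  shows "h m / h n \<le> 2 * ((1 + 2 * \<nu>) * (real m / real n)) powr (2 * \<nu>)"
proof -
  have d: "damping \<nu> m > 0" "damping \<nu> n > 0" using nu damping_pos by auto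
  have "h m = (real m + \<nu>) / (real m + 2 * \<nu>) * (1 / damping \<nu> m)"
    by (simp add: h_def)
  also have "\<dots> \<le> 1 * (1 / damping \<nu> m)"
    using d nu by (intro mult_right_mono) auto
  finally have "h m \<le> 1 / damping \<nu> m" by simp
  moreover have "1 / h n = (real n + 2 * \<nu>) / (real n + \<nu>) * damping \<nu> n"
    by (simp add: h_def)
  moreover have "\<dots> \<le> 2 * damping \<nu> n"
    using d nu by (intro mult_right_mono) (auto simp: pos_divide_le_eq)
  ultimately have "h m \<le> 1 / damping \<nu> m" "1 / h n \<le> 2 * damping \<nu> n"
    by simp_all
  then have "h m * (1 / h n) \<le> (1 / damping \<nu> m) * (2 * damping \<nu> n)"
    using h_pos d by (intro mult_mono) (auto simp: less_imp_le)
  also have "\<dots> \<le> 2 * ((1 + 2 * \<nu>) * (real m / real n)) powr (2 * \<nu>)"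
    using damping_ratio_le[OF nu assms] by simp
  finally show ?thesis by simp
qed

section \<open>Decay with a constant depending on \<nu> alone\<close>

text \<open>\<open>K\<close> bounds \<open>z * (s * real n + 1)\<close> in \<open>decay\<close>; the
  summands of \<open>C\<close> serve \<open>n * s\<close> up to \<open>2 + 2 * \<nu>\<close> and
  beyond it.\<close>

definition K where "K = (1 + 2 * \<nu>) * (4 + 4 * \<nu>)"
definition C where "C = M2 * (3 + 2 * \<nu>) powr \<nu> +
  sqrt (8 * (1 + \<nu>) * (1 + 3 * \<nu>) * exp (2 * D)) * M2 * K powr \<nu>"

lemma decay: "\<bar>u n\<bar> \<le> C / (s * real n + 1) powr \<nu>"
proof -
  define c where "c = sqrt (8 * (1 + \<nu>) * (1 + 3 * \<nu>) * exp (2 * D))"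
  have pos: "M2 * (3 + 2 * \<nu>) powr \<nu> \<ge> 0" "c * M2 * K powr \<nu> \<ge> 0"
    using M2_ge nu by (auto simp: c_def)
  have "\<bar>u n\<bar> * (s * real n + 1) powr \<nu> \<le> C"
  proof (cases "real n * s \<le> 2 + 2 * \<nu>")
    case True
    then have "(s * real n + 1) powr \<nu> \<le> (3 + 2 * \<nu>) powr \<nu>"
      using nu s(1) by (intro powr_mono2) (auto simp: mult.commute)
    then have "\<bar>u n\<bar> * (s * real n + 1) powr \<nu> \<le> M2 * (3 + 2 * \<nu>) powr \<nu>"
      using u_bound M2_ge by (intro mult_mono) auto
    then show ?thesis using pos(2) unfolding C_def c_def by linarith
  next
    case False
    then have s0: "s > 0" using nu s(1) by (cases "s = 0") auto
    have n0: "n > 0" using False nu by (cases n) auto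
    \<comment> \<open>The first index where \<open>turan_definite\<close> applies. As
      \<open>s \<le> 1\<close>, rounding up keeps \<open>m * s\<close> below the case threshold, so
      \<open>m \<le> n\<close>; \<open>turan\<close> is carried from \<open>m\<close> to
      \<open>n\<close>.\<close>
    define m where "m = nat \<lceil>(1 + 2 * \<nu>) / s\<rceil>"
    have m: "(1 + 2 * \<nu>) / s \<le> real m" "real m < (1 + 2 * \<nu>) / s + 1"
      using s0 nu unfolding m_def by (auto simp: of_nat_nat) linarith
    have ms: "1 + 2 * \<nu> \<le> real m * s" "real m * s \<le> 2 + 2 * \<nu>"
    proof -
      show "1 + 2 * \<nu> \<le> real m * s" using m(1) s0 by (simp add: field_simps)
      have "real m * s \<le> ((1 + 2 * \<nu>) / s + 1) * s" using m(2) s0 by (intro mult_right_mono) auto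
      also have "\<dots> = 1 + 2 * \<nu> + s" using s0 by (simp add: field_simps)
      finally show "real m * s \<le> 2 + 2 * \<nu>" using s(3) by simp
    qed
    have "real m * s < real n * s" using ms False by linarith
    then have mn: "m \<le> n" using s0 by simp
    have m1: "m \<ge> 1" using ms nu by (cases m) auto
    have ns: "1 + 2 * \<nu> \<le> real n * s" using False by simp
    define z where "z = (1 + 2 * \<nu>) * (real m / real n)"
    have z0: "z \<ge> 0" using nu by (simp add: z_def)
    have "turan n = (h n * turan n) / h n" using h_pos[of n] by simp
    also have "\<dots> \<le> (h m * turan m * exp (2 * D)) / h n"
      using turan_growth[OF ms(1) mn] h_pos[of n] by (intro divide_right_mono) auto
    also have "\<dots> \<le> (h m * ((1 + 3 * \<nu>) * M2\<^sup>2 * s\<^sup>2) * exp (2 * D)) / h n"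
      using turan_upper[of m] h_pos ms nu by (intro divide_right_mono mult_right_mono mult_left_mono) (auto simp: less_imp_le)
    also have "\<dots> = (h m / h n) * ((1 + 3 * \<nu>) * M2\<^sup>2 * s\<^sup>2 * exp (2 * D))" by simp
    also have "\<dots> \<le> (2 * z powr (2 * \<nu>)) * ((1 + 3 * \<nu>) * M2\<^sup>2 * s\<^sup>2 * exp (2 * D))"
      using h_ratio[OF m1 mn] nu unfolding z_def by (intro mult_right_mono) auto
    finally have tn: "turan n \<le> (2 * z powr (2 * \<nu>)) * ((1 + 3 * \<nu>) * M2\<^sup>2 * s\<^sup>2 * exp (2 * D))" .
    have "s\<^sup>2 * (u n)\<^sup>2 \<le> 4 * (1 + \<nu>) * turan n" by (rule turan_definite(2)[OF ns])
    also have "\<dots> \<le> 4 * (1 + \<nu>) * ((2 * z powr (2 * \<nu>)) * ((1 + 3 * \<nu>) * M2\<^sup>2 * s\<^sup>2 * exp (2 * D)))"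
      using tn nu by (intro mult_left_mono) auto
    also have "\<dots> = s\<^sup>2 * ((8 * (1 + \<nu>) * (1 + 3 * \<nu>) * exp (2 * D)) * M2\<^sup>2 * z powr (2 * \<nu>))"
      by (simp add: algebra_simps)
    finally have "s\<^sup>2 * (u n)\<^sup>2 \<le> s\<^sup>2 * ((8 * (1 + \<nu>) * (1 + 3 * \<nu>) * exp (2 * D)) * M2\<^sup>2 * z powr (2 * \<nu>))" .
    then have "(u n)\<^sup>2 \<le> (8 * (1 + \<nu>) * (1 + 3 * \<nu>) * exp (2 * D)) * M2\<^sup>2 * z powr (2 * \<nu>)"
      using s0 by simp
    also have "\<dots> = (c * M2 * z powr \<nu>)\<^sup>2"
    proof -
      have "z powr (2 * \<nu>) = (z powr \<nu>)\<^sup>2"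
        by (simp add: power2_eq_square powr_add[symmetric])
      moreover have "c\<^sup>2 = 8 * (1 + \<nu>) * (1 + 3 * \<nu>) * exp (2 * D)"
        using nu by (simp add: c_def)
      ultimately show ?thesis by (simp add: power_mult_distrib)
    qed
    finally have u: "\<bar>u n\<bar> \<le> c * M2 * z powr \<nu>"
      using M2_ge nu by (simp add: abs_le_square_iff[symmetric] abs_mult c_def)
    have "z * (s * real n + 1) \<le> K"
    proof -
      have "s * real n + 1 \<le> 2 * (real n * s)" using False nu by (simp add: mult.commute)
      then have "z * (s * real n + 1) \<le> z * (2 * (real n * s))" using z0 by (intro mult_left_mono)
      also have "\<dots> = 2 * (1 + 2 * \<nu>) * (real m * s)" using n0 by (simp add: z_def)
      also have "\<dots> \<le> 2 * (1 + 2 * \<nu>) * (2 + 2 * \<nu>)" using ms(2) nu by (intro mult_left_mono) auto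
      finally show ?thesis by (simp add: K_def algebra_simps)
    qed
    then have zK: "(z * (s * real n + 1)) powr \<nu> \<le> K powr \<nu>"
      using z0 s0 nu by (intro powr_mono2) auto
    have "\<bar>u n\<bar> * (s * real n + 1) powr \<nu> \<le> c * M2 * z powr \<nu> * (s * real n + 1) powr \<nu>"
      using u by (intro mult_right_mono) auto
    also have "\<dots> = c * M2 * (z * (s * real n + 1)) powr \<nu>" by (simp add: powr_mult)
    also have "\<dots> \<le> c * M2 * K powr \<nu>"
      using zK M2_ge nu by (intro mult_left_mono) (auto simp: c_def)
    finally show ?thesis using pos(1) unfolding C_def c_def by linarith
  qed
  moreover have "(s * real n + 1) powr \<nu> > 0"
    using s(1) by (smt (verit) mult_nonneg_nonneg of_nat_0_le_iff powr_gt_zero)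
  ultimately show ?thesis by (simp add: pos_le_divide_eq)
qed

end

section \<open>Solutions with prescribed initial values\<close>

text \<open>Initial values \<open>1, x\<close> give the ultraspherical polynomials and
  \<open>0, 1\<close> the associated ones, both divided by
  \<open>ultra_scale \<nu> n\<close>.\<close>

fun ultra_rec :: "real \<Rightarrow> real \<Rightarrow> real \<Rightarrow> real \<Rightarrow> nat \<Rightarrow> real" where
  "ultra_rec \<nu> x a b 0 = a"
| "ultra_rec \<nu> x a b (Suc 0) = b"
| "ultra_rec \<nu> x a b (Suc (Suc n)) =
     (2 * (real n + 1 + \<nu>) * x * ultra_rec \<nu> x a b (Suc n) - (real n + 1) * ultra_rec \<nu> x a b n)
     / (real n + 1 + 2 * \<nu>)"

text \<open>The locale constant \<open>C\<close> is built from \<nu> only, so one bound serves all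
  \<open>x\<close>, \<open>a\<close>, \<open>b\<close>; its absolute value is the witness.\<close>

lemma ultra_rec_decay:
  assumes "\<nu> > 1/2"
  obtains C where "C \<ge> 0" "\<And>x a b n. \<bar>x\<bar> \<le> 1 \<Longrightarrow> \<bar>a\<bar> \<le> 1 \<Longrightarrow> \<bar>x * a - b\<bar> \<le> 1 \<Longrightarrow>
    \<bar>ultra_rec \<nu> x a b n\<bar> \<le> C / (sqrt (1 - x\<^sup>2) * real n + 1) powr \<nu>"
proof
  fix x a b :: real and n
  assume "\<bar>x\<bar> \<le> 1" "\<bar>a\<bar> \<le> 1" "\<bar>x * a - b\<bar> \<le> 1"
  then interpret ultra_solution \<nu> x "ultra_rec \<nu> x a b"
    using assms by unfold_locales auto
  have "\<bar>ultra_rec \<nu> x a b n\<bar> \<le> C / (s * real n + 1) powr \<nu>" by (rule decay)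
  also have "\<dots> \<le> \<bar>C\<bar> / (s * real n + 1) powr \<nu>" by (intro divide_right_mono) auto
  finally show "\<bar>ultra_rec \<nu> x a b n\<bar> \<le> \<bar>C\<bar> / (sqrt (1 - x\<^sup>2) * real n + 1) powr \<nu>"
    by (simp add: s_def)
qed simp

lemma ultra_rec_const_at_1: "\<nu> > 0 \<Longrightarrow> ultra_rec \<nu> 1 1 1 n = 1"
  by (induction \<nu> "1::real" "1::real" "1::real" n rule: ultra_rec.induct) (auto simp: field_simps)

text \<open>At \<open>x = 1\<close> one has \<open>s = 0\<close>, so the increments of the solution
  obey the first-order recursion of \<open>damping\<close>.\<close>

lemma ultra_rec_assoc_at_1:
  assumes "\<nu> > 0"
  shows "ultra_rec \<nu> 1 0 1 n = (\<Sum>k<n. damping \<nu> k)"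
  using assms
proof (induction \<nu> "1::real" "0::real" "1::real" n rule: ultra_rec.induct)
  case (3 \<nu> n)
  have "(real n + 1 + 2 * \<nu>) * damping \<nu> (Suc n) = (real n + 1) * damping \<nu> n"
    using 3 by (simp add: damping_Suc)
  then show ?case using 3 by (simp add: field_simps)
qed auto

section \<open>Co-dilated polynomials\<close>

text \<open>\<open>ultra_scale \<nu> n\<close> is the value at 1 of the monic ultraspherical polynomial of degree \<open>n\<close>.\<close>

definition ultra_scale :: "real \<Rightarrow> nat \<Rightarrow> real" where
  "ultra_scale \<nu> n = (\<Prod>k<n. (real k + 2 * \<nu>) / (2 * (real k + \<nu>)))"

lemma ultra_scale_Suc:
  "ultra_scale \<nu> (Suc n) = ultra_scale \<nu> n * ((real n + 2 * \<nu>) / (2 * (real n + \<nu>)))"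
  by (simp add: ultra_scale_def)

lemma ultra_scale_pos: "\<nu> > 0 \<Longrightarrow> ultra_scale \<nu> n > 0"
  unfolding ultra_scale_def by (rule prod_pos) (auto intro!: divide_pos_pos)

text \<open>The altered coefficient enters only at degree 2, so degrees 1 and 2 are checked directly
  and both sides then share a recurrence. At \<open>n = 0\<close> the right side would be
  \<open>lam\<close>.\<close>

lemma poly_codilated:
  assumes "\<nu> > 0" "n \<ge> 1"
  shows "poly (codilated \<nu> lam n) x =
    ultra_scale \<nu> n * (lam * ultra_rec \<nu> x 1 x n + (1 - lam) * x * ultra_rec \<nu> x 0 1 n)"
  using assms
proof (induction \<nu> lam n rule: codilated.induct)
  case (2 \<nu> lam)
  then show ?case by (simp add: ultra_scale_def algebra_simps)
next
  case (3 \<nu> lam)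
  then show ?case
    by (simp add: ultra_scale_def ultra_beta_def divide_simps)
      (simp add: algebra_simps power2_eq_square)
next
  case (4 \<nu> lam n)
  define W where "W k = lam * ultra_rec \<nu> x 1 x k + (1 - lam) * x * ultra_rec \<nu> x 0 1 k" for k
  define N where "N = real n + 2"
  have N: "N \<ge> 2" "real (Suc n) = N - 1" "real (Suc (Suc n)) = N" by (auto simp: N_def)
  have U: "ultra_rec \<nu> x a b (Suc (Suc (Suc n))) =
    (2 * (N + \<nu>) * x * ultra_rec \<nu> x a b (Suc (Suc n)) - N * ultra_rec \<nu> x a b (Suc n)) / (N + 2 * \<nu>)" for a b
    by (simp only: ultra_rec.simps(3)[of _ _ _ _ "Suc n"] N(2)) simp
  have W: "W (Suc (Suc (Suc n))) = (2 * (N + \<nu>) * x * W (Suc (Suc n)) - N * W (Suc n)) / (N + 2 * \<nu>)"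
    unfolding W_def U using 4 N(1)
    by (simp add: divide_simps del: ultra_rec.simps) (simp add: algebra_simps del: ultra_rec.simps)
  have k3: "ultra_scale \<nu> (Suc (Suc (Suc n))) = ultra_scale \<nu> (Suc (Suc n)) * ((N + 2 * \<nu>) / (2 * (N + \<nu>)))"
    by (simp only: ultra_scale_Suc N)
  have k2: "ultra_scale \<nu> (Suc (Suc n)) = ultra_scale \<nu> (Suc n) * ((N - 1 + 2 * \<nu>) / (2 * (N - 1 + \<nu>)))"
    by (simp only: ultra_scale_Suc N)
  \<comment> \<open>The second factor is the ratio of consecutive values of
    \<open>ultra_scale\<close>.\<close>
  have b: "ultra_beta \<nu> (Suc (Suc n)) = N / (2 * (N + \<nu>)) * ((N - 1 + 2 * \<nu>) / (2 * (N - 1 + \<nu>)))"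
    unfolding ultra_beta_def N by (simp add: algebra_simps)
  have "ultra_scale \<nu> (Suc (Suc (Suc n))) * W (Suc (Suc (Suc n))) =
    ultra_scale \<nu> (Suc (Suc n)) * ((2 * (N + \<nu>) * x * W (Suc (Suc n)) - N * W (Suc n)) / (2 * (N + \<nu>)))"
    unfolding k3 W using 4 N(1) by simp
  also have "\<dots> = x * (ultra_scale \<nu> (Suc (Suc n)) * W (Suc (Suc n)))
      - ultra_scale \<nu> (Suc (Suc n)) * (N / (2 * (N + \<nu>))) * W (Suc n)"
    using 4 N(1) by (simp add: field_simps)
  also have "ultra_scale \<nu> (Suc (Suc n)) * (N / (2 * (N + \<nu>))) = ultra_beta \<nu> (Suc (Suc n)) * ultra_scale \<nu> (Suc n)"
    unfolding k2 b by (simp add: mult_ac)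
  finally show ?case
    using 4 unfolding W_def by simp
qed simp

text \<open>The factor is affine in the damping sum: for \<open>lam \<le> 1\<close> the lower bound
  on the sum is used, otherwise the upper bound \<open>2 * \<nu> / (2 * \<nu> - 1)\<close>, which
  produces the zero at \<open>lam = 2 * \<nu>\<close>.\<close>

lemma codilated_factor_at_1:
  assumes nu: "\<nu> > 1/2" and lam: "lam < 2 * \<nu>" and n: "n \<ge> 2"
  shows "lam + (1 - lam) * (\<Sum>k<n. damping \<nu> k) \<ge> (2 * \<nu> - lam) / (2 * \<nu> + 1)"
proof -
  let ?S = "\<Sum>k<n. damping \<nu> k"
  show ?thesis
  proof (cases "lam \<le> 1")
    case True
    have "(1 - lam) * ?S \<ge> (1 - lam) * (1 + 1 / (2 * \<nu> + 1))"
      using sum_damping_ge[of \<nu> n] nu n True by (intro mult_left_mono) auto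
    moreover have "lam + (1 - lam) * (1 + 1 / (2 * \<nu> + 1)) = (2 * \<nu> - lam) / (2 * \<nu> + 1) + 2 / (2 * \<nu> + 1)"
      using nu by (simp add: divide_simps) (simp add: algebra_simps)
    moreover have "2 / (2 * \<nu> + 1) \<ge> 0" using nu by simp
    ultimately show ?thesis by linarith
  next
    case False
    have "(lam - 1) * ?S \<le> (lam - 1) * (2 * \<nu> / (2 * \<nu> - 1))"
      using sum_damping_less[OF nu, of n] False by (intro mult_left_mono) auto
    moreover have "lam - (lam - 1) * (2 * \<nu> / (2 * \<nu> - 1)) = (2 * \<nu> - lam) / (2 * \<nu> - 1)"
      using nu by (simp add: divide_simps) (simp add: algebra_simps)
    moreover have "(2 * \<nu> - lam) / (2 * \<nu> + 1) \<le> (2 * \<nu> - lam) / (2 * \<nu> - 1)"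
      using nu lam by (intro divide_left_mono) auto
    ultimately show ?thesis by (simp add: algebra_simps)
  qed
qed

lemma codilated_ratio_bound:
  assumes nu: "\<nu> > 1/2"
  obtains C where "C \<ge> 0"
    "\<And>lam n. lam < 2 * \<nu> \<Longrightarrow> n \<ge> 1 \<Longrightarrow> poly (codilated \<nu> lam n) 1 > 0"
    "\<And>lam n x. lam < 2 * \<nu> \<Longrightarrow> n \<ge> 1 \<Longrightarrow> \<bar>x\<bar> \<le> 1 \<Longrightarrow>
      \<bar>poly (codilated \<nu> lam n) x / poly (codilated \<nu> lam n) 1\<bar>
       \<le> (1 + \<bar>lam\<bar>) / (2 * \<nu> - lam) * (C / (sqrt (1 - x\<^sup>2) * real n + 1) powr \<nu>)"
proof -
  obtain C where C: "C \<ge> 0" "\<And>x a b n. \<bar>x\<bar> \<le> 1 \<Longrightarrow> \<bar>a\<bar> \<le> 1 \<Longrightarrow> \<bar>x * a - b\<bar> \<le> 1 \<Longrightarrow>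
    \<bar>ultra_rec \<nu> x a b n\<bar> \<le> C / (sqrt (1 - x\<^sup>2) * real n + 1) powr \<nu>"
    using ultra_rec_decay[OF nu] by metis
  define S where "S n = (\<Sum>k<n. damping \<nu> k)" for n
  \<comment> \<open>\<open>2 * C\<close> comes from the two solutions in the numerator,
    \<open>2 powr \<nu>\<close> from \<open>n = 1\<close>, and \<open>2 * \<nu> + 1\<close> from the
    lower bound on the factor at 1.\<close>
  define C' where "C' = (2 * \<nu> + 1) * (2 * C + 2 powr \<nu>)"
  have P1: "poly (codilated \<nu> lam n) 1 = ultra_scale \<nu> n * (lam + (1 - lam) * S n)" if "n \<ge> 1" for lam n
    using that nu by (simp add: poly_codilated ultra_rec_const_at_1 ultra_rec_assoc_at_1 S_def)
  have fac: "lam + (1 - lam) * S n > 0" if "lam < 2 * \<nu>" "n \<ge> 1" for lam n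
  proof (cases "n = 1")
    case True then show ?thesis by (simp add: S_def)
  next
    case False
    have "(2 * \<nu> - lam) / (2 * \<nu> + 1) > 0" using nu that by simp
    with codilated_factor_at_1[OF nu that(1), of n] that(2) False show ?thesis
      unfolding S_def by linarith
  qed
  show ?thesis
  proof (rule that[of C'])
    show "C' \<ge> 0" using C(1) nu by (simp add: C'_def)
    show pos: "poly (codilated \<nu> lam n) 1 > 0" if "lam < 2 * \<nu>" "n \<ge> 1" for lam n
      using P1[OF that(2)] fac[OF that] ultra_scale_pos[of \<nu> n] nu by simp
    fix lam x :: real and n :: nat
    assume lam: "lam < 2 * \<nu>" and n: "n \<ge> 1" and x: "\<bar>x\<bar> \<le> 1"
    define d where "d = (sqrt (1 - x\<^sup>2) * real n + 1) powr \<nu>"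
    have x2: "x\<^sup>2 \<le> 1" using x by (simp add: abs_square_le_1)
    have "sqrt (1 - x\<^sup>2) * real n \<ge> 0" using x2 by simp
    then have d0: "d > 0" unfolding d_def by (smt (verit) powr_gt_zero)
    have "\<bar>poly (codilated \<nu> lam n) x / poly (codilated \<nu> lam n) 1\<bar>
       \<le> (1 + \<bar>lam\<bar>) / (2 * \<nu> - lam) * (C' / d)"
    proof (cases "n = 1")
      case True
      have "d \<le> 2 powr \<nu>" unfolding d_def True
        using x2 nu by (intro powr_mono2) auto
      then have "d \<le> 2 * C + 2 powr \<nu>" using C(1) by linarith
      then have 1: "1 \<le> (2 * C + 2 powr \<nu>) / d" using d0 by simp
      \<comment> \<open>For \<open>n = 1\<close> the ratio is \<open>x\<close> itself, so the
        prefactor must stay above \<open>1 / (2 * \<nu> + 1)\<close>.\<close>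
      have "2 * \<nu> - lam \<le> (1 + \<bar>lam\<bar>) * (2 * \<nu> + 1)"
      proof -
        have "\<bar>lam\<bar> * (2 * \<nu>) \<ge> 0" using nu by simp
        moreover have "(1 + \<bar>lam\<bar>) * (2 * \<nu> + 1) = 2 * \<nu> + 1 + \<bar>lam\<bar> + \<bar>lam\<bar> * (2 * \<nu>)"
          by (simp add: algebra_simps)
        ultimately show ?thesis by linarith
      qed
      then have 2: "1 \<le> (1 + \<bar>lam\<bar>) / (2 * \<nu> - lam) * (2 * \<nu> + 1)" using lam by (simp add: field_simps)
      have "\<bar>poly (codilated \<nu> lam n) x / poly (codilated \<nu> lam n) 1\<bar> \<le> 1 * 1" using x True by simp
      also have "\<dots> \<le> ((1 + \<bar>lam\<bar>) / (2 * \<nu> - lam) * (2 * \<nu> + 1)) * ((2 * C + 2 powr \<nu>) / d)"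
        by (rule mult_mono[OF 2 1]) (use 2 in auto)
      finally show ?thesis by (simp add: C'_def)
    next
      case False
      let ?p = "ultra_rec \<nu> x 1 x n" and ?q = "ultra_rec \<nu> x 0 1 n"
      have k: "ultra_scale \<nu> n > 0" using nu by (simp add: ultra_scale_pos)
      have pq: "\<bar>?p\<bar> \<le> C / d" "\<bar>?q\<bar> \<le> C / d" unfolding d_def using x by (auto intro!: C(2))
      have num: "\<bar>lam * ?p + (1 - lam) * x * ?q\<bar> \<le> (1 + \<bar>lam\<bar>) * (2 * (C / d))"
      proof -
        have "\<bar>lam * ?p + (1 - lam) * x * ?q\<bar> \<le> \<bar>lam * ?p\<bar> + \<bar>(1 - lam) * x * ?q\<bar>" by simp
        also have "\<dots> = \<bar>lam\<bar> * \<bar>?p\<bar> + \<bar>1 - lam\<bar> * \<bar>x\<bar> * \<bar>?q\<bar>" by (simp add: abs_mult)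
        also have "\<dots> \<le> (1 + \<bar>lam\<bar>) * (C / d) + (1 + \<bar>lam\<bar>) * 1 * (C / d)"
          using pq x by (intro add_mono mult_mono) auto
        also have "\<dots> = (1 + \<bar>lam\<bar>) * (2 * (C / d))" by simp
        finally show ?thesis .
      qed
      have den: "(2 * \<nu> - lam) / (2 * \<nu> + 1) \<le> lam + (1 - lam) * S n"
        using codilated_factor_at_1[OF nu lam, of n] n False by (simp add: S_def)
      have "\<bar>poly (codilated \<nu> lam n) x / poly (codilated \<nu> lam n) 1\<bar> =
        \<bar>lam * ?p + (1 - lam) * x * ?q\<bar> / (lam + (1 - lam) * S n)"
      proof -
        have "poly (codilated \<nu> lam n) x = ultra_scale \<nu> n * (lam * ?p + (1 - lam) * x * ?q)"
          using nu n by (simp add: poly_codilated)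
        then show ?thesis
          unfolding P1[OF n] using k fac[OF lam n] by (simp add: abs_mult)
      qed
      also have "\<dots> \<le> ((1 + \<bar>lam\<bar>) * (2 * (C / d))) / ((2 * \<nu> - lam) / (2 * \<nu> + 1))"
        using num den lam nu C(1) d0 by (intro frac_le) auto
      also have "\<dots> = (1 + \<bar>lam\<bar>) / (2 * \<nu> - lam) * (((2 * \<nu> + 1) * (2 * C)) / d)"
        by (simp add: mult_ac) (simp add: algebra_simps)
      also have "\<dots> \<le> (1 + \<bar>lam\<bar>) / (2 * \<nu> - lam) * (C' / d)"
        using lam d0 nu by (intro mult_left_mono divide_right_mono) (auto simp: C'_def)
      finally show ?thesis .
    qed
    then show "\<bar>poly (codilated \<nu> lam n) x / poly (codilated \<nu> lam n) 1\<bar>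
       \<le> (1 + \<bar>lam\<bar>) / (2 * \<nu> - lam) * (C' / (sqrt (1 - x\<^sup>2) * real n + 1) powr \<nu>)"
      unfolding d_def .
  qed
qed

section \<open>Transfer to residual polynomials and the modulus of convergence\<close>

theorem theorem4p4:
  fixes \<nu> :: real
  assumes "\<nu> > 1 / 2"
  shows "\<exists>C::real. \<forall>lam::real. \<forall>n::nat. lam < 2 * \<nu> \<longrightarrow> n \<ge> 1 \<longrightarrow>
    poly (codilated \<nu> lam n) 1 \<noteq> 0 \<and>
    (\<forall>x\<in>{-1..1}. \<bar>poly (codilated \<nu> lam n) x / poly (codilated \<nu> lam n) 1\<bar>
       \<le> (1 + \<bar>lam\<bar>) / (2 * \<nu> - lam) * (C / (sqrt (1 - x\<^sup>2) * real n + 1) powr \<nu>)) \<and>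
    (\<forall>y\<in>{0..1}. \<bar>residual \<nu> lam n y\<bar>
       \<le> (1 + \<bar>lam\<bar>) / (2 * \<nu> - lam) * (C / (2 * sqrt (y * (1 - y)) * real n + 1) powr \<nu>)) \<and>
    modulus_conv \<nu> lam n \<le> (1 + \<bar>lam\<bar>) / (2 * \<nu> - lam) * (C / (2 * real n) powr \<nu>)"
proof -
  obtain C where C: "C \<ge> 0"
    "\<And>lam n. lam < 2 * \<nu> \<Longrightarrow> n \<ge> 1 \<Longrightarrow> poly (codilated \<nu> lam n) 1 > 0"
    "\<And>lam n x. lam < 2 * \<nu> \<Longrightarrow> n \<ge> 1 \<Longrightarrow> \<bar>x\<bar> \<le> 1 \<Longrightarrow>
      \<bar>poly (codilated \<nu> lam n) x / poly (codilated \<nu> lam n) 1\<bar>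
       \<le> (1 + \<bar>lam\<bar>) / (2 * \<nu> - lam) * (C / (sqrt (1 - x\<^sup>2) * real n + 1) powr \<nu>)"
    using codilated_ratio_bound[OF assms] by metis
  show ?thesis
  proof (intro exI[of _ C] allI impI conjI ballI)
    fix lam :: real and n :: nat
    assume lam: "lam < 2 * \<nu>" and n: "n \<ge> 1"
    let ?G = "(1 + \<bar>lam\<bar>) / (2 * \<nu> - lam)"
    have G: "?G \<ge> 0" using lam by simp
    show "poly (codilated \<nu> lam n) 1 \<noteq> 0" using C(2)[OF lam n] by simp
    show "\<bar>poly (codilated \<nu> lam n) x / poly (codilated \<nu> lam n) 1\<bar>
       \<le> ?G * (C / (sqrt (1 - x\<^sup>2) * real n + 1) powr \<nu>)" if "x \<in> {-1..1}" for x
      using that by (intro C(3)[OF lam n]) auto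
    show res: "\<bar>residual \<nu> lam n y\<bar> \<le> ?G * (C / (2 * sqrt (y * (1 - y)) * real n + 1) powr \<nu>)"
      if "y \<in> {0..1}" for y
    proof -
      have "1 - (1 - 2 * y)\<^sup>2 = 2\<^sup>2 * (y * (1 - y))" by (simp add: power2_eq_square algebra_simps)
      then have "sqrt (1 - (1 - 2 * y)\<^sup>2) = 2 * sqrt (y * (1 - y))"
        by (simp only: real_sqrt_mult real_sqrt_abs)
      then show ?thesis
        using C(3)[OF lam n, of "1 - 2 * y"] that unfolding residual_def by (simp add: abs_le_iff)
    qed
    show "modulus_conv \<nu> lam n \<le> ?G * (C / (2 * real n) powr \<nu>)"
      unfolding modulus_conv_def
    proof (rule cSUP_least)
      fix y :: real
      assume y: "y \<in> {0..1}"
      define t where "t = sqrt (y * (1 - y))"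
      have t0: "t \<ge> 0" using y by (simp add: t_def)
      have yt: "y powr (\<nu> / 2) * (1 - y) powr (\<nu> / 2) = t powr \<nu>"
        using y by (simp add: t_def powr_mult[symmetric] powr_half_sqrt[symmetric] powr_powr)
      \<comment> \<open>The weight \<open>t powr \<nu>\<close> compensates the decay in
        \<open>t\<close>; the product form also covers the endpoints, where
        \<open>t = 0\<close>.\<close>
      have "t powr \<nu> * (2 * real n) powr \<nu> = (2 * t * real n) powr \<nu>"
        using t0 by (simp add: powr_mult[symmetric] mult_ac)
      also have "\<dots> \<le> (2 * t * real n + 1) powr \<nu>" using t0 assms by (intro powr_mono2) auto
      finally have le: "t powr \<nu> / (2 * t * real n + 1) powr \<nu> \<le> 1 / (2 * real n) powr \<nu>"
        using n by (simp add: pos_le_divide_eq) (simp add: divide_le_eq_1)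
      have "\<bar>y powr (\<nu> / 2) * (1 - y) powr (\<nu> / 2) * residual \<nu> lam n y\<bar> = t powr \<nu> * \<bar>residual \<nu> lam n y\<bar>"
        unfolding yt by (simp add: abs_mult)
      also have "\<dots> \<le> t powr \<nu> * (?G * (C / (2 * t * real n + 1) powr \<nu>))"
        using res[OF y] unfolding t_def by (intro mult_left_mono) auto
      also have "\<dots> = ?G * (C * (t powr \<nu> / (2 * t * real n + 1) powr \<nu>))" by simp
      also have "\<dots> \<le> ?G * (C * (1 / (2 * real n) powr \<nu>))"
        using le G C(1) by (intro mult_left_mono)
      finally show "\<bar>y powr (\<nu> / 2) * (1 - y) powr (\<nu> / 2) * residual \<nu> lam n y\<bar>
        \<le> ?G * (C / (2 * real n) powr \<nu>)" by simp
    qed simp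
  qed
qed

end
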